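(* Let $k$ be an odd positive integer and let $F_k:\mathbb{N}\to\mathbb{N}$ be given by $F_k(n)=\frac{3n+k}{2}$ if $n$ is odd and $F_k(n)=\frac{n}{2}$ if $n$ is even. Let $s\ge1$ and let $u_1,d_1,\dots,u_s,d_s$ be positive integers. Let $T_0$ be a positive integer whose trajectory $x_0=T_0$, $x_{t+1}=F_k(x_t)$, follows the orb sequence $(u_1,d_1,\dots,u_s,d_s)$, i.e. among $x_0,x_1,\dots,x_{U+D-1}$ the first $u_1$ are odd, the next $d_1$ are even, the next $u_2$ are odd, the next $d_2$ are even, and so on, ending with $d_s$ even values. Then $$F_k^{U+D}(T_0)=\frac{3^{U}T_0+k\alpha}{2^{U+D}},$$ where $U=\sum_{i=1}^s u_i$, $D=\sum_{i=1}^s d_i$ and $$\alpha=\sum_{i=1}^{s} 2^{\sum_{j=1}^{i-1}(u_j+d_j)}\,(3^{u_i}-2^{u_i})\,3^{\sum_{j=i+1}^{s}u_j}$$ (empty sums are $0$).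
   Context: $F_k^j$ denotes the $j$-fold iterate of $F_k$. An "orb" is a maximal block of consecutive odd iterates (an up iteration, of length $u_i$) followed by a block of consecutive even iterates (a down iteration, of length $d_i$). *)

theory Defs
  imports Complex_Main
begin

text \<open>For odd \<open>n\<close> the division is exact, since \<open>k\<close> is always taken to be odd.\<close>

definition F :: "nat \<Rightarrow> nat \<Rightarrow> nat" where
  "F k n = (if odd n then (3 * n + k) div 2 else n div 2)"

text \<open>
  The lengths \<open>u i\<close>, \<open>d i\<close> are only meaningful for \<open>i \<in> {1..s}\<close>.
  \<open>orb_start u d i\<close> is the time at which the \<open>i\<close>-th orb begins.
\<close>

definition orb_start :: "(nat \<Rightarrow> nat) \<Rightarrow> (nat \<Rightarrow> nat) \<Rightarrow> nat \<Rightarrow> nat" where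
  "orb_start u d i = (\<Sum>j\<in>{1..<i}. u j + d j)"

text \<open>
  Only the parities at the times before the end of the \<open>s\<close>-th orb are prescribed; the
  parity of the iterate reached after it is left open.
\<close>

definition follows_orbs ::
  "nat \<Rightarrow> nat \<Rightarrow> nat \<Rightarrow> (nat \<Rightarrow> nat) \<Rightarrow> (nat \<Rightarrow> nat) \<Rightarrow> bool" where
  "follows_orbs k T\<^sub>0 s u d \<longleftrightarrow>
     (\<forall>i\<in>{1..s}.
        (\<forall>t\<in>{orb_start u d i..<orb_start u d i + u i}. odd ((F k ^^ t) T\<^sub>0)) \<and>
        (\<forall>t\<in>{orb_start u d i + u i..<orb_start u d i + u i + d i}. even ((F k ^^ t) T\<^sub>0)))"

definition orb_alpha :: "nat \<Rightarrow> (nat \<Rightarrow> nat) \<Rightarrow> (nat \<Rightarrow> nat) \<Rightarrow> int" where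
  "orb_alpha s u d =
     (\<Sum>i\<in>{1..s}. 2 ^ (\<Sum>j\<in>{1..<i}. u j + d j) * (3 ^ u i - 2 ^ u i) * 3 ^ (\<Sum>j\<in>{i+1..s}. u j))"

end

theory Submission
  imports Defs
begin

text \<open>For odd \<open>x\<close> one has F(x) + k = 3(x + k)/2, so m odd steps multiply x + k by
  (3/2)^m; subtracting k again explains the term k(3^m - 2^m) in \<open>F_funpow_odd_block\<close>.
  Even steps only halve (\<open>F_funpow_even_block\<close>), so a whole orb is an affine map with
  known coefficients (\<open>F_funpow_orb\<close>). Composing these maps by induction on the number
  of orbs gives the formula, because the constant term obeys the recurrence
  \<open>orb_alpha_Suc\<close>. Everything is kept in integers with denominators cleared; division
  by the power of 2 happens only in the final theorem.\<close>

lemma F_funpow_odd_block: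
  assumes "odd k" and "\<And>j. j < m \<Longrightarrow> odd ((F k ^^ j) n)"
  shows "2 ^ m * int ((F k ^^ m) n) = 3 ^ m * int n + int k * (3 ^ m - 2 ^ m)"
  using assms(2)
proof (induction m)
  case 0
  then show ?case by simp
next
  case (Suc m)
  let ?x = "(F k ^^ m) n"
  have "odd ?x" using Suc.prems by simp
  \<comment> \<open>Both k and the iterate are odd, so the truncating \<open>div\<close> in
    \<open>F\<close> is exact here.\<close>
  then have "2 * F k ?x = 3 * ?x + k"
    using assms(1) by (simp add: F_def)
  then have "2 * int (F k ?x) = 3 * int ?x + int k"
    by linarith
  then have "2 ^ Suc m * int (F k ?x) = 2 ^ m * (3 * int ?x + int k)"
    by (simp only: power_Suc2 mult.assoc)
  also have "\<dots> = 3 * (2 ^ m * int ?x) + 2 ^ m * int k"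
    by (simp add: algebra_simps)
  also have "2 ^ m * int ?x = 3 ^ m * int n + int k * (3 ^ m - 2 ^ m)"
    using Suc by simp
  finally show ?case by (simp add: algebra_simps)
qed

lemma F_funpow_even_block:
  assumes "\<And>j. j < m \<Longrightarrow> even ((F k ^^ j) n)"
  shows "2 ^ m * (F k ^^ m) n = n"
  using assms
proof (induction m)
  case (Suc m)
  then have "even ((F k ^^ m) n)" by blast
  then have "2 * F k ((F k ^^ m) n) = (F k ^^ m) n"
    by (simp add: F_def)
  then have "2 ^ Suc m * F k ((F k ^^ m) n) = 2 ^ m * (F k ^^ m) n"
    by (simp only: power_Suc2 mult.assoc)
  also have "\<dots> = n"
    using Suc by simp
  finally show ?case by simp
qed simp

text \<open>The b halvings only add the factor 2^b on the left; the right-hand side is that of the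
  odd block alone.\<close>

lemma F_funpow_orb:
  assumes "odd k"
    and up: "\<And>j. j < a \<Longrightarrow> odd ((F k ^^ j) n)"
    and down: "\<And>j. a \<le> j \<Longrightarrow> j < a + b \<Longrightarrow> even ((F k ^^ j) n)"
  shows "2 ^ (a + b) * int ((F k ^^ (a + b)) n) = 3 ^ a * int n + int k * (3 ^ a - 2 ^ a)"
proof -
  have shift: "(F k ^^ j) ((F k ^^ a) n) = (F k ^^ (a + j)) n" for j
    by (metis add.commute comp_apply funpow_add)
  then have "2 ^ b * (F k ^^ b) ((F k ^^ a) n) = (F k ^^ a) n"
    using down by (intro F_funpow_even_block) simp
  then have "2 ^ b * int ((F k ^^ (a + b)) n) = int ((F k ^^ a) n)"
    unfolding shift by (metis of_nat_mult of_nat_numeral of_nat_power)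
  then show ?thesis
    using F_funpow_odd_block[OF \<open>odd k\<close> up] by (simp add: power_add mult.assoc)
qed

text \<open>The nominal start of orb s + 1 is the moment at which the first s orbs end, whether or
  not another orb follows. It serves as the clock of the induction.\<close>

lemma orb_start_Suc: "orb_start u d (Suc s) = (\<Sum>i\<in>{1..s}. u i) + (\<Sum>i\<in>{1..s}. d i)"
  by (simp add: orb_start_def atLeastLessThanSuc_atLeastAtMost sum.distrib)

text \<open>An appended orb multiplies every old summand by 3^u, for u its number of odd steps, and
  leaves the powers of 2 alone, since these depend on earlier orbs only. The new summand has an
  empty exponent of 3.\<close>

lemma orb_alpha_Suc:
  "orb_alpha (Suc s) u d =
     3 ^ u (Suc s) * orb_alpha s u d
     + 2 ^ orb_start u d (Suc s) * (3 ^ u (Suc s) - 2 ^ u (Suc s))"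
proof -
  have "(\<Sum>j\<in>{i+1..Suc s}. u j) = (\<Sum>j\<in>{i+1..s}. u j) + u (Suc s)" if "i \<in> {1..s}" for i
    using that by simp
  then have "(\<Sum>i\<in>{1..s}. 2 ^ orb_start u d i * (3 ^ u i - 2 ^ u i) * 3 ^ (\<Sum>j\<in>{i+1..Suc s}. u j))
      = 3 ^ u (Suc s) * orb_alpha s u d"
    unfolding orb_alpha_def orb_start_def sum_distrib_left
    by (intro sum.cong) (simp_all only: power_add mult_ac)
  then show ?thesis
    by (simp add: orb_alpha_def orb_start_def)
qed

lemma follows_orbs_imp_funpow_orb_start:
  assumes "odd k" and "follows_orbs k n s u d"
  shows "2 ^ orb_start u d (Suc s) * int ((F k ^^ orb_start u d (Suc s)) n) =
           3 ^ (\<Sum>i\<in>{1..s}. u i) * int n + int k * orb_alpha s u d"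
  using assms(2)
proof (induction s)
  case 0
  then show ?case by (simp add: orb_start_def orb_alpha_def)
next
  case (Suc s)
  let ?t = "orb_start u d (Suc s)" and ?a = "u (Suc s)" and ?b = "d (Suc s)"
  let ?x = "(F k ^^ ?t) n"
  have shift: "(F k ^^ j) ?x = (F k ^^ (?t + j)) n" for j
    by (metis add.commute comp_apply funpow_add)
  have start: "orb_start u d (Suc (Suc s)) = ?t + (?a + ?b)"
    by (simp add: orb_start_Suc)
  have "Suc s \<in> {1..Suc s}" by simp
  with Suc.prems have
    up: "\<And>t. t \<in> {?t..<?t + ?a} \<Longrightarrow> odd ((F k ^^ t) n)" and
    down: "\<And>t. t \<in> {?t + ?a..<?t + ?a + ?b} \<Longrightarrow> even ((F k ^^ t) n)"
    unfolding follows_orbs_def by blast+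
  have orb: "2 ^ (?a + ?b) * int ((F k ^^ (?t + (?a + ?b))) n)
      = 3 ^ ?a * int ?x + int k * (3 ^ ?a - 2 ^ ?a)"
    unfolding shift[symmetric]
  proof (rule F_funpow_orb[OF \<open>odd k\<close>], goal_cases)
    case (1 j)
    then show ?case using up[of "?t + j"] by (simp add: shift)
  next
    case (2 j)
    then show ?case using down[of "?t + j"] by (simp add: shift)
  qed
  \<comment> \<open>Scaling the identity of the last orb by \<open>2 ^ ?t\<close> makes
    \<open>2 ^ ?t * int ?x\<close> appear, which the induction hypothesis evaluates; the leftover
    term is the new summand of \<open>orb_alpha\<close>.\<close>
  have "2 ^ (?t + (?a + ?b)) * int ((F k ^^ (?t + (?a + ?b))) n)
      = 2 ^ ?t * (3 ^ ?a * int ?x + int k * (3 ^ ?a - 2 ^ ?a))"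
    unfolding power_add[of _ ?t] mult.assoc orb ..
  also have "\<dots> = 3 ^ ?a * (2 ^ ?t * int ?x) + int k * (2 ^ ?t * (3 ^ ?a - 2 ^ ?a))"
    by (simp add: algebra_simps)
  also have "2 ^ ?t * int ?x = 3 ^ (\<Sum>i\<in>{1..s}. u i) * int n + int k * orb_alpha s u d"
  proof (rule Suc.IH)
    show "follows_orbs k n s u d"
      using Suc.prems unfolding follows_orbs_def by (meson atLeastAtMost_iff le_SucI)
  qed
  finally show ?case
    by (simp add: start orb_alpha_Suc power_add algebra_simps)
qed

theorem theorem3:
  fixes k s T\<^sub>0 U D :: nat and u d :: "nat \<Rightarrow> nat"
  assumes "odd k"
    and "s \<ge> 1"
    and "\<And>i. i \<in> {1..s} \<Longrightarrow> u i > 0"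
    and "\<And>i. i \<in> {1..s} \<Longrightarrow> d i > 0"
    and "T\<^sub>0 > 0"
    and "follows_orbs k T\<^sub>0 s u d"
    and "U = (\<Sum>i\<in>{1..s}. u i)"
    and "D = (\<Sum>i\<in>{1..s}. d i)"
  shows "real ((F k ^^ (U + D)) T\<^sub>0) =
           (3 ^ U * real T\<^sub>0 + real k * real_of_int (orb_alpha s u d)) / 2 ^ (U + D)"
proof -
  have time: "orb_start u d (Suc s) = U + D"
    using assms(7,8) by (simp add: orb_start_Suc)
  have "2 ^ (U + D) * int ((F k ^^ (U + D)) T\<^sub>0) = 3 ^ U * int T\<^sub>0 + int k * orb_alpha s u d"
    using follows_orbs_imp_funpow_orb_start[OF assms(1,6)] unfolding time assms(7) .
  from arg_cong[OF this, of real_of_int]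
  show ?thesis
    by (simp add: eq_divide_eq mult.commute)
qed

end
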